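(* Consider the contract game with compensation contract $\pi_i(y_1,\dots,y_n)=\delta_i-\gamma_i(\hat{x}-y_i)^2$. If $\lim_{a_i\to\infty}f_i(a_i)=\infty$ for all $i\in\{1,\dots,n\}$, then a contract equilibrium exists.
   Context: There are $n$ sensors. Sensor $i$ chooses an effort $a_i\in\mathbb{R}_{\geq 0}$ and reports $y_i=x+w_i$, where $x\in\mathbb{R}$ is the unknown quantity being measured and, for each action tuple $(a_1,\dots,a_n)$, $w_i$ is a zero-mean random variable with variance $\mathbb{E}\{w_i^2\}=\eta_i(a_i)$, and $\mathbb{E}\{w_iw_j\}=0$ for $i\neq j$. Standing assumptions: $\eta_i:\mathbb{R}_{\geq 0}\to\mathbb{R}_{\geq 0}$ is twice continuously differentiable and strictly decreasing; $f_i:\mathbb{R}_{\geq 0}\to\mathbb{R}$ (cost of effort) is twice continuously differentiable and strictly increasing. The central planner uses the averaging estimate $\hat{x}=\frac1n(y_1+\dots+y_n)$ and pays sensor $i$ the compensation $p_i=\pi_i(y_1,\dots,y_n)=\delta_i-\gamma_i(\hat{x}-y_i)^2$, with constants $\gamma_i,\delta_i\in\mathbb{R}_{\geq 0}$. With $\alpha_i\in\mathbb{R}_{\geq 0}$ the value-of-compensation, the utility of sensor $i$ is $\bar{C}_i(a_i,a_{-i})=\alpha_i\mathbb{E}\{p_i\}-f_i(a_i)$, where $a_{-i}=(a_j)_{j\neq i}$. An action tuple $(a_i^* )_{i=1}^n\in\mathbb{R}_{\geq 0}^n$ is a contract equilibrium if $a_i^*\in\operatorname*{arg\,max}_{a_i\in\mathbb{R}_{\geq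 0}}\bar{C}_i(a_i,a_{-i}^* )$ for all $i\in\{1,\dots,n\}$. *)

theory Defs
  imports "HOL-Probability.Probability"
begin

text \<open>Sensors are the elements of a finite type \<open>'n\<close>, so the number of sensors is \<open>CARD('n)\<close>,
  and action tuples are functions \<open>'n \<Rightarrow> real\<close>.\<close>

text \<open>Derivatives are taken within \<open>S\<close>; for \<open>S = {0..}\<close> they are one-sided at 0.\<close>

definition twice_continuously_differentiable_on :: "real set \<Rightarrow> (real \<Rightarrow> real) \<Rightarrow> bool" where
  "twice_continuously_differentiable_on S g \<longleftrightarrow>
     (\<exists>g' g''. (\<forall>t\<in>S. (g has_real_derivative g' t) (at t within S)) \<and>
               (\<forall>t\<in>S. (g' has_real_derivative g'' t) (at t within S)) \<and>
               continuous_on S g'')"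

text \<open>Both the probability space \<open>M a\<close> and the noise variables \<open>w a i\<close> may depend on the action
  tuple \<open>a\<close>. Square integrability is explicit because the Bochner integral of a non-integrable
  function is 0; on a probability space it implies that each \<open>w a i\<close> and each product
  \<open>w a i * w a j\<close> is integrable.\<close>

definition noise_model ::
  "(('n::finite \<Rightarrow> real) \<Rightarrow> 'w measure) \<Rightarrow> (('n \<Rightarrow> real) \<Rightarrow> 'n \<Rightarrow> 'w \<Rightarrow> real) \<Rightarrow>
   ('n \<Rightarrow> real \<Rightarrow> real) \<Rightarrow> bool" where
  "noise_model M w \<eta> \<longleftrightarrow>
     (\<forall>a. (\<forall>i. 0 \<le> a i) \<longrightarrow>
        prob_space (M a) \<and>
        (\<forall>i. w a i \<in> borel_measurable (M a) \<and>
             integrable (M a) (\<lambda>\<omega>. (w a i \<omega>)\<^sup>2) \<and>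
             (LINT \<omega>|M a. w a i \<omega>) = 0 \<and>
             (LINT \<omega>|M a. (w a i \<omega>)\<^sup>2) = \<eta> i (a i)) \<and>
        (\<forall>i j. i \<noteq> j \<longrightarrow> (LINT \<omega>|M a. w a i \<omega> * w a j \<omega>) = 0))"

definition report ::
  "real \<Rightarrow> (('n::finite \<Rightarrow> real) \<Rightarrow> 'n \<Rightarrow> 'w \<Rightarrow> real) \<Rightarrow> ('n \<Rightarrow> real) \<Rightarrow> 'w \<Rightarrow> 'n \<Rightarrow> real" where
  "report x w a \<omega> i = x + w a i \<omega>"

definition averaging_estimate :: "('n::finite \<Rightarrow> real) \<Rightarrow> real" where
  "averaging_estimate y = (\<Sum>j\<in>UNIV. y j) / real CARD('n)"

definition compensation ::
  "('n::finite \<Rightarrow> real) \<Rightarrow> ('n \<Rightarrow> real) \<Rightarrow> 'n \<Rightarrow> ('n \<Rightarrow> real) \<Rightarrow> real" where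
  "compensation \<delta> \<gamma> i y = \<delta> i - \<gamma> i * (averaging_estimate y - y i)\<^sup>2"

text \<open>A contract is a family \<open>\<pi>\<close>, where \<open>\<pi> i y\<close> is the payment to sensor \<open>i\<close> for the reports \<open>y\<close>.\<close>

definition utility ::
  "(('n::finite \<Rightarrow> real) \<Rightarrow> 'w measure) \<Rightarrow> (('n \<Rightarrow> real) \<Rightarrow> 'n \<Rightarrow> 'w \<Rightarrow> real) \<Rightarrow> real \<Rightarrow>
   ('n \<Rightarrow> ('n \<Rightarrow> real) \<Rightarrow> real) \<Rightarrow> ('n \<Rightarrow> real) \<Rightarrow> ('n \<Rightarrow> real \<Rightarrow> real) \<Rightarrow>
   'n \<Rightarrow> ('n \<Rightarrow> real) \<Rightarrow> real" where
  "utility M w x \<pi> \<alpha> f i a = \<alpha> i * (LINT \<omega>|M a. \<pi> i (report x w a \<omega>)) - f i (a i)"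

definition contract_equilibrium ::
  "('n::finite \<Rightarrow> ('n \<Rightarrow> real) \<Rightarrow> real) \<Rightarrow> ('n \<Rightarrow> real) \<Rightarrow> bool" where
  "contract_equilibrium C a \<longleftrightarrow>
     (\<forall>i. 0 \<le> a i) \<and> (\<forall>i. is_arg_max (\<lambda>b. C i (a(i := b))) (\<lambda>b. 0 \<le> b) (a i))"

end

theory Submission imports Defs begin

text \<open>The deviation of the average from the report of sensor \<open>i\<close> is a linear combination
  of the noises in which the unknown quantity cancels. Because the noises are uncorrelated, its
  second moment is a weighted sum of the variances \<open>\<eta> j (a j)\<close>, without mixed terms
  (lemmas \<open>expected_square_uncorrelated_sum\<close> and \<open>utility_eq\<close>). The utility of
  sensor \<open>i\<close> is therefore additively separable: up to a term that depends only on the actions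
  of the others, it equals \<open>- (k * \<eta> i (a i) + f i (a i))\<close> with a constant \<open>k \<ge> 0\<close>.

  So the players do not interact strategically, and no fixed point theorem is called for: it
  suffices that each sensor separately minimises \<open>k * \<eta> i b + f i b\<close> over \<open>b \<ge> 0\<close>. This function
  is continuous, and it is coercive because \<open>\<eta> i\<close> is nonnegative and the cost of effort tends to
  infinity, so a minimiser exists (lemma \<open>continuous_coercive_attains_min\<close>). Any family of
  minimisers is an equilibrium, even one in dominant strategies.\<close>

lemma twice_continuously_differentiable_on_imp_continuous_on:
  assumes "twice_continuously_differentiable_on S g"
  shows "continuous_on S g"
  using assms unfolding twice_continuously_differentiable_on_def
  by (meson DERIV_continuous_on)

text \<open>Beyond some point \<open>h\<close> is at least its value at the left end of the half-line, so the minimum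
  over a compact initial interval is global.\<close>

lemma continuous_coercive_attains_min:
  fixes h :: "real \<Rightarrow> real"
  assumes cont: "continuous_on {c..} h" and lim: "filterlim h at_top at_top"
  obtains b where "c \<le> b" and "\<And>t. c \<le> t \<Longrightarrow> h b \<le> h t"
proof -
  obtain T where T: "\<And>t. T \<le> t \<Longrightarrow> h c \<le> h t"
    using lim unfolding filterlim_at_top eventually_at_top_linorder by meson
  have "continuous_on {c..max c T} h"
    using cont by (rule continuous_on_subset) auto
  then obtain b where b: "b \<in> {c..max c T}" "\<And>t. t \<in> {c..max c T} \<Longrightarrow> h b \<le> h t"
    using continuous_attains_inf[of "{c..max c T}" h] by auto
  have "h b \<le> h t" if "c \<le> t" for t
  proof (cases "t \<le> max c T")
    case True
    then show ?thesis using b that by auto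
  next
    case False
    then have "h c \<le> h t" using T by auto
    moreover have "h b \<le> h c" using b by auto
    ultimately show ?thesis by linarith
  qed
  then show thesis using that[of b] b by auto
qed

text \<open>Only the diagonal of the expanded square survives. The mixed products are integrable because
  \<open>\<bar>u v\<bar> \<le> u\<^sup>2 + v\<^sup>2\<close>.\<close>

lemma expected_square_uncorrelated_sum:
  fixes X :: "'i \<Rightarrow> 'w \<Rightarrow> real" and c :: "'i \<Rightarrow> real"
  assumes fin: "finite I"
    and meas: "\<And>i. i \<in> I \<Longrightarrow> X i \<in> borel_measurable N"
    and sq: "\<And>i. i \<in> I \<Longrightarrow> integrable N (\<lambda>\<omega>. (X i \<omega>)\<^sup>2)"
    and uncorr: "\<And>i j. \<lbrakk>i \<in> I; j \<in> I; i \<noteq> j\<rbrakk> \<Longrightarrow> (LINT \<omega>|N. X i \<omega> * X j \<omega>) = 0"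
  shows "integrable N (\<lambda>\<omega>. (\<Sum>i\<in>I. c i * X i \<omega>)\<^sup>2)"
    and "(LINT \<omega>|N. (\<Sum>i\<in>I. c i * X i \<omega>)\<^sup>2) = (\<Sum>i\<in>I. (c i)\<^sup>2 * (LINT \<omega>|N. (X i \<omega>)\<^sup>2))"
proof -
  have prod: "integrable N (\<lambda>\<omega>. X i \<omega> * X j \<omega>)" if "i \<in> I" "j \<in> I" for i j
  proof (rule Bochner_Integration.integrable_bound)
    show "integrable N (\<lambda>\<omega>. (X i \<omega>)\<^sup>2 + (X j \<omega>)\<^sup>2)"
      using sq that by auto
    show "(\<lambda>\<omega>. X i \<omega> * X j \<omega>) \<in> borel_measurable N"
      using meas that by auto
    have "\<bar>u * v\<bar> \<le> u\<^sup>2 + v\<^sup>2" for u v :: real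
    proof -
      have "2 * \<bar>u * v\<bar> \<le> u\<^sup>2 + v\<^sup>2"
        using sum_squares_bound[of "\<bar>u\<bar>" "\<bar>v\<bar>"] by (simp add: abs_mult)
      then show ?thesis using abs_ge_zero[of "u * v"] by linarith
    qed
    then show "AE \<omega> in N. norm (X i \<omega> * X j \<omega>) \<le> norm ((X i \<omega>)\<^sup>2 + (X j \<omega>)\<^sup>2)"
      by auto
  qed
  have expand: "(\<Sum>i\<in>I. c i * X i \<omega>)\<^sup>2 = (\<Sum>i\<in>I. \<Sum>j\<in>I. c i * c j * (X i \<omega> * X j \<omega>))" for \<omega>
    by (simp add: power2_eq_square sum_product mult_ac)
  show "integrable N (\<lambda>\<omega>. (\<Sum>i\<in>I. c i * X i \<omega>)\<^sup>2)"
    unfolding expand using prod by auto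
  have "(LINT \<omega>|N. (\<Sum>i\<in>I. c i * X i \<omega>)\<^sup>2)
      = (\<Sum>i\<in>I. \<Sum>j\<in>I. c i * c j * (LINT \<omega>|N. X i \<omega> * X j \<omega>))"
    unfolding expand using prod by (simp add: Bochner_Integration.integral_sum)
  also have "\<dots> = (\<Sum>i\<in>I. \<Sum>j\<in>I. if j = i then (c i)\<^sup>2 * (LINT \<omega>|N. (X i \<omega>)\<^sup>2) else 0)"
    using uncorr by (intro sum.cong) (auto simp: power2_eq_square)
  also have "\<dots> = (\<Sum>i\<in>I. (c i)\<^sup>2 * (LINT \<omega>|N. (X i \<omega>)\<^sup>2))"
    using fin by simp
  finally show "(LINT \<omega>|N. (\<Sum>i\<in>I. c i * X i \<omega>)\<^sup>2)
      = (\<Sum>i\<in>I. (c i)\<^sup>2 * (LINT \<omega>|N. (X i \<omega>)\<^sup>2))" .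
qed

definition deviation_weight :: "'n::finite \<Rightarrow> 'n \<Rightarrow> real" where
  "deviation_weight i j = 1 / real CARD('n) - (if j = i then 1 else 0)"

text \<open>The weights of the deviation add up to \<open>0\<close>, which is why the measured quantity \<open>x\<close> cancels.\<close>

lemma averaging_estimate_minus_report:
  fixes w :: "('n::finite \<Rightarrow> real) \<Rightarrow> 'n \<Rightarrow> 'w \<Rightarrow> real"
  shows "averaging_estimate (report x w a \<omega>) - report x w a \<omega> i
    = (\<Sum>j\<in>UNIV. deviation_weight i j * w a j \<omega>)"
proof -
  have "(\<Sum>j\<in>UNIV. deviation_weight i j * w a j \<omega>)
      = (\<Sum>j\<in>UNIV. w a j \<omega> / real CARD('n) - (if j = i then w a j \<omega> else 0))"
    by (intro sum.cong) (auto simp: deviation_weight_def algebra_simps)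
  also have "\<dots> = (\<Sum>j\<in>UNIV. w a j \<omega>) / real CARD('n) - w a i \<omega>"
    by (simp add: sum_subtractf sum_divide_distrib)
  finally show ?thesis
    by (simp add: averaging_estimate_def report_def sum.distrib add_divide_distrib)
qed

text \<open>In this form the actions of the others enter only through a constant summand, so they
  cannot influence which action is best for sensor \<open>i\<close>.\<close>

lemma utility_eq:
  fixes M :: "('n::finite \<Rightarrow> real) \<Rightarrow> 'w measure"
  assumes model: "noise_model M w \<eta>" and nonneg: "\<And>i. 0 \<le> a i"
  shows "utility M w x (compensation \<delta> \<gamma>) \<alpha> f i a
    = \<alpha> i * (\<delta> i - \<gamma> i * (\<Sum>j\<in>UNIV. (deviation_weight i j)\<^sup>2 * \<eta> j (a j))) - f i (a i)"
proof -
  have "prob_space (M a)"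
    and meas: "w a j \<in> borel_measurable (M a)"
    and sq: "integrable (M a) (\<lambda>\<omega>. (w a j \<omega>)\<^sup>2)"
    and var: "(LINT \<omega>|M a. (w a j \<omega>)\<^sup>2) = \<eta> j (a j)"
    and uncorr: "j \<noteq> k \<Longrightarrow> (LINT \<omega>|M a. w a j \<omega> * w a k \<omega>) = 0" for j k
    using model nonneg unfolding noise_model_def by blast+
  then interpret prob_space "M a" by simp
  let ?D = "\<lambda>\<omega>. (\<Sum>j\<in>UNIV. deviation_weight i j * w a j \<omega>)\<^sup>2"
  have "(LINT \<omega>|M a. compensation \<delta> \<gamma> i (report x w a \<omega>))
      = (LINT \<omega>|M a. \<delta> i - \<gamma> i * ?D \<omega>)"
    by (simp add: compensation_def averaging_estimate_minus_report)
  also have "\<dots> = \<delta> i - \<gamma> i * (LINT \<omega>|M a. ?D \<omega>)"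
    using expected_square_uncorrelated_sum(1)[of UNIV "w a" "M a", OF _ meas sq uncorr]
    by (simp add: prob_space)
  also have "(LINT \<omega>|M a. ?D \<omega>) = (\<Sum>j\<in>UNIV. (deviation_weight i j)\<^sup>2 * \<eta> j (a j))"
    using expected_square_uncorrelated_sum(2)[of UNIV "w a" "M a", OF _ meas sq uncorr]
    by (simp add: var)
  finally show ?thesis by (simp add: utility_def)
qed

theorem proposition2:
  fixes M :: "('n::finite \<Rightarrow> real) \<Rightarrow> 'w measure"
    and w :: "('n \<Rightarrow> real) \<Rightarrow> 'n \<Rightarrow> 'w \<Rightarrow> real"
    and x :: real
    and \<eta> f :: "'n \<Rightarrow> real \<Rightarrow> real"
    and \<alpha> \<gamma> \<delta> :: "'n \<Rightarrow> real"
  assumes "noise_model M w \<eta>"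
    and "\<And>i t. 0 \<le> t \<Longrightarrow> 0 \<le> \<eta> i t"
    and "\<And>i. twice_continuously_differentiable_on {0..} (\<eta> i)"
    and "\<And>i. strict_antimono_on {0..} (\<eta> i)"
    and "\<And>i. twice_continuously_differentiable_on {0..} (f i)"
    and "\<And>i. strict_mono_on {0..} (f i)"
    and "\<And>i. 0 \<le> \<alpha> i" and "\<And>i. 0 \<le> \<gamma> i" and "\<And>i. 0 \<le> \<delta> i"
    and "\<And>i. filterlim (f i) at_top at_top"
  shows "\<exists>a. contract_equilibrium (utility M w x (compensation \<delta> \<gamma>) \<alpha> f) a"
proof -
  define k where "k i = \<alpha> i * \<gamma> i * (deviation_weight i i)\<^sup>2" for i
  have k_nonneg: "0 \<le> k i" for i
    using assms(7,8) by (simp add: k_def)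
  have "\<exists>b\<ge>0. \<forall>t\<ge>0. k i * \<eta> i b + f i b \<le> k i * \<eta> i t + f i t" for i
  proof -
    have cont: "continuous_on {0..} (\<lambda>t. k i * \<eta> i t + f i t)"
      using assms(3,5)
      by (intro continuous_intros twice_continuously_differentiable_on_imp_continuous_on)
    have "eventually (\<lambda>t. f i t \<le> k i * \<eta> i t + f i t) at_top"
      using eventually_ge_at_top[of 0] by eventually_elim (simp add: k_nonneg assms(2))
    then have "filterlim (\<lambda>t. k i * \<eta> i t + f i t) at_top at_top"
      by (rule filterlim_at_top_mono[OF assms(10)])
    then show ?thesis
      by (rule continuous_coercive_attains_min[OF cont]) blast
  qed
  then obtain a where a_nonneg: "\<And>i. 0 \<le> a i"
    and a_min: "\<And>i t. 0 \<le> t \<Longrightarrow> k i * \<eta> i (a i) + f i (a i) \<le> k i * \<eta> i t + f i t"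
    by metis
  let ?U = "utility M w x (compensation \<delta> \<gamma>) \<alpha> f"
  have "is_arg_max (\<lambda>b. ?U i (a(i := b))) (\<lambda>b. 0 \<le> b) (a i)" for i
  proof -
    define R where "R = (\<Sum>j\<in>UNIV - {i}. (deviation_weight i j)\<^sup>2 * \<eta> j (a j))"
    have split: "?U i (a(i := b)) = \<alpha> i * (\<delta> i - \<gamma> i * R) - (k i * \<eta> i b + f i b)"
      if "0 \<le> b" for b
    proof -
      have "(\<Sum>j\<in>UNIV. (deviation_weight i j)\<^sup>2 * \<eta> j ((a(i := b)) j))
          = (deviation_weight i i)\<^sup>2 * \<eta> i b + R"
        by (simp add: R_def sum.remove[of UNIV i])
      moreover have "0 \<le> (a(i := b)) j" for j
        using a_nonneg that by simp
      ultimately show ?thesis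
        by (simp add: utility_eq[OF assms(1)] k_def algebra_simps del: fun_upd_apply)
          (simp add: algebra_simps)
    qed
    have "?U i (a(i := b)) \<le> ?U i (a(i := a i))" if "0 \<le> b" for b
      unfolding split[OF that] split[OF a_nonneg] using a_min[OF that, of i] by linarith
    then show ?thesis
      unfolding is_arg_max_def using a_nonneg by (meson not_less)
  qed
  then show ?thesis
    unfolding contract_equilibrium_def using a_nonneg by blast
qed

end
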